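(* Fix positive constants $\alpha>1$, $\beta$ and $\gamma$, and let $m=\beta n^{\alpha}$, $p=\gamma n^{-(1+\alpha)/2}$. Then w.h.p. the class of random intersection graphs $G(n,m,p)$ defined by these constants has bounded expansion: there is a function $f$ such that for every $r\ge 0$, $\Pr[\tilde\nabla_r(G(n,m,p))\le f(r)]\to 1$ as $n\to\infty$.
   Context: Random intersection graph $G(n,m,p)$: take a random bipartite graph $B=(V,A,E)$ with $|V|=n$ vertices, $|A|=m$ attributes, each of the $nm$ possible $V$–$A$ edges present independently with probability $p$; $G(n,m,p)$ has vertex set $V$ and two distinct vertices are adjacent iff they have a common neighbour in $B$. "W.h.p." means with probability tending to $1$ as $n\to\infty$. For half-integer $r\ge0$, $H$ is an $r$-shallow topological minor of $G$ if $G$ contains as a subgraph a subdivision of $H$ in which every edge of $H$ is replaced by a path of length at most $2r+1$. The density of a graph is $|E|/|V|$, and $\tilde\nabla_r(G)$ denotes the maximum density of an $r$-shallow topological minor of $G$. *)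

theory Defs
  imports Complex_Main
begin

text \<open>Random bipartite graph B = (V, A, E) with V = {0..<n}, A = {0..<m}; an outcome is an
 edge set E \<subseteq> V \<times> A.  Each of the n*m pairs is present independently with probability p,
 so the probability of an event Q (a predicate on edge sets) is the following finite sum.\<close>

definition rbg_prob :: "nat \<Rightarrow> nat \<Rightarrow> real \<Rightarrow> ((nat \<times> nat) set \<Rightarrow> bool) \<Rightarrow> real" where
  "rbg_prob n m p Q =
     (\<Sum>E \<in> Pow ({0..<n} \<times> {0..<m}).
        (if Q E then p ^ card E * (1 - p) ^ (n * m - card E) else 0))"

definition ig_adj :: "(nat \<times> nat) set \<Rightarrow> nat \<Rightarrow> nat \<Rightarrow> bool" where
  "ig_adj E u v \<longleftrightarrow> u \<noteq> v \<and> (\<exists>a. (u, a) \<in> E \<and> (v, a) \<in> E)"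

definition ig_path :: "nat \<Rightarrow> (nat \<times> nat) set \<Rightarrow> nat list \<Rightarrow> bool" where
  "ig_path n E P \<longleftrightarrow> P \<noteq> [] \<and> distinct P \<and> set P \<subseteq> {0..<n} \<and>
     (\<forall>i. Suc i < length P \<longrightarrow> ig_adj E (P ! i) (P ! Suc i))"

definition simple_graph :: "nat set \<Rightarrow> nat set set \<Rightarrow> bool" where
  "simple_graph VH EH \<longleftrightarrow> finite VH \<and> (\<forall>e\<in>EH. e \<subseteq> VH \<and> card e = 2)"

text \<open>H is an r-shallow topological minor of G, where r = k/2 (k :: nat, so r ranges over
 the non-negative half-integers): G contains a subdivision of H in which every edge is replaced
 by a path of length (number of edges) at most 2r+1 = k+1.  phi maps branch vertices,
 path e is the path replacing edge e; paths are internally disjoint from each other and from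
 the branch vertices.\<close>
definition shallow_top_minor :: "nat \<Rightarrow> nat set \<Rightarrow> nat set set \<Rightarrow> nat \<Rightarrow> (nat \<times> nat) set \<Rightarrow> bool" where
  "shallow_top_minor k VH EH n E \<longleftrightarrow> simple_graph VH EH \<and>
     (\<exists>phi path.
        inj_on phi VH \<and> phi ` VH \<subseteq> {0..<n} \<and>
        (\<forall>e\<in>EH. ig_path n E (path e) \<and> {hd (path e), last (path e)} = phi ` e \<and>
                 length (path e) - 1 \<le> k + 1 \<and>
                 set (butlast (tl (path e))) \<inter> phi ` VH = {}) \<and>
        (\<forall>e\<in>EH. \<forall>e'\<in>EH. e \<noteq> e' \<longrightarrow>
                 set (butlast (tl (path e))) \<inter> set (butlast (tl (path e'))) = {}))"

text \<open>\<nabla>~_r(G), r = k/2: maximum density |E(H)|/|V(H)| over (non-empty) r-shallow topological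
 minors H of G.  Graphs H are taken with vertices in nat, which is no loss since every finite
 graph is isomorphic to one.\<close>
definition top_grad :: "nat \<Rightarrow> nat \<Rightarrow> (nat \<times> nat) set \<Rightarrow> real" where
  "top_grad k n E = Sup {real (card EH) / real (card VH) | VH EH.
                         VH \<noteq> {} \<and> shallow_top_minor k VH EH n E}"

end

theory Submission
  imports Defs "HOL-Library.FuncSet"
begin

text \<open>
  Since \<open>n p = \<gamma> n powr ((1 - \<alpha>) / 2)\<close>, a first moment bound shows that w.h.p. every attribute has at
  most \<open>s\<close> neighbours, for a constant \<open>s\<close>. Each path of a subdivision can be shortcut so that it uses
  no attribute twice, and each attribute then meets at most \<open>2 ^ s\<close> paths. Hence a greedy choice keeps
  a fraction \<open>1 / ((k + 1) * 2 ^ s)\<close> of the paths such that no attribute is used twice altogether.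

  For such a rainbow system all bipartite edges are distinct, so its probability is the same as if the
  edges of the intersection graph were independent with probability \<open>m p\<^sup>2 \<le> c / n\<close>. Summing over all
  interior vertices and attributes, each path contributes a factor at most \<open>K / n\<close>, so the expected
  number of rainbow systems with \<open>h\<close> branch vertices and \<open>f h\<close> paths is at most
  \<open>(n choose h) * ((h choose 2) choose (f h)) * (K / n) ^ (f h)\<close>. For large constant \<open>f\<close> the sum of this
  over \<open>1 \<le> h \<le> n\<close> is at most \<open>1 / n\<close>.
\<close>

subsection \<open>Union bounds\<close>

text \<open>Take the product over all pairs of \<open>p + (1 - p)\<close>, with the second summand
  replaced by 0 on \<open>T\<close>. Expanding it gives one term per edge set \<open>E\<close>: zero
  unless \<open>E\<close> contains \<open>T\<close>, and the weight of \<open>E\<close>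
  otherwise.\<close>

lemma rbg_prob_superset:
  assumes "T \<subseteq> {0..<n} \<times> {0..<m}"
  shows "rbg_prob n m p (\<lambda>E. T \<subseteq> E) = p ^ card T"
proof -
  let ?X = "{0..<n} \<times> {0..<m}"
  have fin: "finite ?X" by simp
  have "(\<Prod>x\<in>?X. p + (if x \<in> T then 0 else 1 - p)) = (\<Prod>x\<in>?X. if x \<in> T then p else 1)"
    by (rule prod.cong) auto
  also have "\<dots> = (\<Prod>x\<in>T. p)"
    using assms fin by (simp add: prod.If_cases Int_absorb1)
  also have "\<dots> = p ^ card T" by simp
  finally have lhs: "(\<Prod>x\<in>?X. p + (if x \<in> T then 0 else 1 - p)) = p ^ card T" .
  have "(\<Prod>x\<in>?X - E. if x \<in> T then 0 else 1 - p) =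
      (if T \<subseteq> E then (1 - p) ^ (n * m - card E) else 0)" if "E \<in> Pow ?X" for E
  proof (cases "T \<subseteq> E")
    case True
    have "(\<Prod>x\<in>?X - E. if x \<in> T then 0 else 1 - p) = (\<Prod>x\<in>?X - E. 1 - p)"
      using True by (intro prod.cong) auto
    also have "\<dots> = (1 - p) ^ (n * m - card E)"
      using that by (simp add: card_Diff_subset finite_subset[OF _ fin])
    finally show ?thesis using True by simp
  next
    case False
    then obtain x where "x \<in> T" "x \<notin> E" by auto
    then show ?thesis using assms False by (auto intro!: prod_zero bexI[of _ x])
  qed
  then show ?thesis
    unfolding rbg_prob_def lhs[symmetric] prod_add[OF fin]
    by (intro sum.cong) auto
qed

lemma rbg_prob_True: "rbg_prob n m p (\<lambda>E. True) = 1"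
  using rbg_prob_superset[of "{}" n m p] by simp

lemma rbg_prob_mono:
  assumes "0 \<le> p" "p \<le> 1" "\<And>E. E \<subseteq> {0..<n} \<times> {0..<m} \<Longrightarrow> Q E \<Longrightarrow> R E"
  shows "rbg_prob n m p Q \<le> rbg_prob n m p R"
  unfolding rbg_prob_def using assms by (intro sum_mono) auto

lemma rbg_prob_le_1:
  assumes "0 \<le> p" "p \<le> 1"
  shows "rbg_prob n m p Q \<le> 1"
  using rbg_prob_mono[OF assms, of n m Q "\<lambda>_. True"] by (simp add: rbg_prob_True)

lemma rbg_prob_not: "rbg_prob n m p (\<lambda>E. \<not> Q E) = 1 - rbg_prob n m p Q"
proof -
  have "rbg_prob n m p Q + rbg_prob n m p (\<lambda>E. \<not> Q E) = rbg_prob n m p (\<lambda>E. True)"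
    unfolding rbg_prob_def sum.distrib[symmetric] by (intro sum.cong) auto
  then show ?thesis by (simp add: rbg_prob_True)
qed

lemma rbg_prob_Bex_le:
  assumes "0 \<le> p" "p \<le> 1" "finite I"
  shows "rbg_prob n m p (\<lambda>E. \<exists>i\<in>I. Q i E) \<le> (\<Sum>i\<in>I. rbg_prob n m p (Q i))"
proof -
  let ?w = "\<lambda>E :: (nat \<times> nat) set. p ^ card E * (1 - p) ^ (n * m - card E)"
  have w: "?w E \<ge> 0" for E using assms by simp
  have "(if \<exists>i\<in>I. Q i E then ?w E else 0) \<le> (\<Sum>i\<in>I. if Q i E then ?w E else 0)" for E
  proof (cases "\<exists>i\<in>I. Q i E")
    case True
    then obtain i where i: "i \<in> I" "Q i E" by auto
    then have "?w E = (if Q i E then ?w E else 0)" by simp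
    also have "\<dots> \<le> (\<Sum>i\<in>I. if Q i E then ?w E else 0)"
      using i assms(3) w by (intro member_le_sum) auto
    finally show ?thesis using True by simp
  next
    case False
    then show ?thesis by (simp add: sum_nonneg w)
  qed
  then have "rbg_prob n m p (\<lambda>E. \<exists>i\<in>I. Q i E) \<le>
      (\<Sum>E\<in>Pow ({0..<n} \<times> {0..<m}). \<Sum>i\<in>I. if Q i E then ?w E else 0)"
    unfolding rbg_prob_def by (intro sum_mono)
  then show ?thesis unfolding rbg_prob_def by (subst sum.swap)
qed

lemma rbg_prob_disj_le:
  assumes "0 \<le> p" "p \<le> 1"
  shows "rbg_prob n m p (\<lambda>E. Q E \<or> R E) \<le> rbg_prob n m p Q + rbg_prob n m p R"
  unfolding rbg_prob_def sum.distrib[symmetric] using assms by (intro sum_mono) auto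

lemma rbg_prob_superset_le:
  assumes "0 \<le> p" "p \<le> 1"
  shows "rbg_prob n m p (\<lambda>E. T \<subseteq> E) \<le> p ^ card T"
proof (cases "T \<subseteq> {0..<n} \<times> {0..<m}")
  case True
  then show ?thesis by (simp add: rbg_prob_superset)
next
  case False
  then have "rbg_prob n m p (\<lambda>E. T \<subseteq> E) = 0"
    unfolding rbg_prob_def by (intro sum.neutral) auto
  then show ?thesis using assms by simp
qed

text \<open>A union bound over an attribute \<open>a\<close> and a set \<open>U\<close> of
  \<open>t\<close> neighbours, with \<open>n choose t \<le> n ^ t\<close>. Since \<open>t\<close> is
  positive, \<open>a\<close> has a neighbour and therefore lies in \<open>{0..<m}\<close>.\<close>

lemma rbg_prob_large_attribute:
  assumes p: "0 \<le> p" "p \<le> 1" and t: "0 < t"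
  shows "rbg_prob n m p (\<lambda>E. \<exists>a. t \<le> card {v. (v, a) \<in> E}) \<le> real m * (real n * p) ^ t"
proof -
  let ?I = "{0..<m} \<times> {U. U \<subseteq> {0..<n} \<and> card U = t}"
  have fin: "finite ?I" by auto
  have "rbg_prob n m p (\<lambda>E. \<exists>a. t \<le> card {v. (v, a) \<in> E}) \<le>
      rbg_prob n m p (\<lambda>E. \<exists>i\<in>?I. snd i \<times> {fst i} \<subseteq> E)"
  proof (rule rbg_prob_mono[OF p])
    fix E :: "(nat \<times> nat) set"
    assume E: "E \<subseteq> {0..<n} \<times> {0..<m}" and "\<exists>a. t \<le> card {v. (v, a) \<in> E}"
    then obtain a where a: "t \<le> card {v. (v, a) \<in> E}" by auto
    then obtain U where U: "U \<subseteq> {v. (v, a) \<in> E}" "card U = t"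
      by (meson obtain_subset_with_card_n)
    then have "U \<noteq> {}" using t by auto
    then have "a \<in> {0..<m}" "U \<subseteq> {0..<n}" using U E by auto
    then show "\<exists>i\<in>?I. snd i \<times> {fst i} \<subseteq> E" using U by (intro bexI[of _ "(a, U)"]) auto
  qed
  also have "\<dots> \<le> (\<Sum>i\<in>?I. rbg_prob n m p (\<lambda>E. snd i \<times> {fst i} \<subseteq> E))"
    by (rule rbg_prob_Bex_le[OF p fin])
  also have "\<dots> \<le> (\<Sum>i\<in>?I. p ^ t)"
  proof (rule sum_mono)
    fix i assume "i \<in> ?I"
    then show "rbg_prob n m p (\<lambda>E. snd i \<times> {fst i} \<subseteq> E) \<le> p ^ t"
      using rbg_prob_superset_le[OF p, of n m "snd i \<times> {fst i}"]
      by (auto simp: card_cartesian_product)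
  qed
  also have "\<dots> = real m * real (n choose t) * p ^ t"
    by (simp add: card_cartesian_product n_subsets)
  also have "\<dots> \<le> real m * real (n ^ t) * p ^ t"
  proof -
    have "n choose t \<le> n ^ t"
      by (cases "t \<le> n") (simp_all add: binomial_le_pow binomial_eq_0)
    then show ?thesis using assms
      by (intro mult_right_mono mult_left_mono) (auto simp del: of_nat_power)
  qed
  finally show ?thesis by (simp add: power_mult_distrib mult.assoc)
qed

subsection \<open>Paths through distinct attributes\<close>

text \<open>Greedy selection: keep some \<open>x\<close>, discard the at most \<open>D\<close>
  elements related to it, among them \<open>x\<close> itself, and continue with the rest.\<close>

lemma pairwise_unrelated_subset:
  assumes "finite X" and "\<And>x. R x x" and "\<And>x y. R x y \<Longrightarrow> R y x"
    and "\<And>x. x \<in> X \<Longrightarrow> card {y \<in> X. R x y} \<le> D"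
  shows "\<exists>Y\<subseteq>X. (\<forall>x\<in>Y. \<forall>y\<in>Y. x \<noteq> y \<longrightarrow> \<not> R x y) \<and> card X \<le> D * card Y"
  using assms(1,4)
proof (induction "card X" arbitrary: X rule: less_induct)
  case less
  show ?case
  proof (cases "X = {}")
    case True
    then show ?thesis by auto
  next
    case False
    then obtain x where x: "x \<in> X" by auto
    let ?N = "{y \<in> X. R x y}"
    have "x \<in> ?N" using x assms(2) by auto
    then have "card (X - ?N) < card X" using x less.prems(1) by (intro psubset_card_mono) auto
    moreover have "card {z \<in> X - ?N. R y z} \<le> D" if "y \<in> X - ?N" for y
    proof -
      have "card {z \<in> X - ?N. R y z} \<le> card {z \<in> X. R y z}"
        using less.prems(1) by (intro card_mono) auto
      also have "\<dots> \<le> D" using less.prems(2) that by auto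
      finally show ?thesis .
    qed
    ultimately obtain Y where Y: "Y \<subseteq> X - ?N" "\<forall>x\<in>Y. \<forall>y\<in>Y. x \<noteq> y \<longrightarrow> \<not> R x y"
        "card (X - ?N) \<le> D * card Y"
      using less.hyps[of "X - ?N"] less.prems(1) by auto
    have "finite Y" using Y(1) less.prems(1) finite_subset by blast
    moreover have "x \<notin> Y" using Y(1) \<open>x \<in> ?N\<close> by auto
    ultimately have c: "card (insert x Y) = Suc (card Y)" by simp
    have "card X = card ?N + card (X - ?N)"
      using less.prems(1) by (subst card_Un_disjoint[symmetric]) (auto intro: arg_cong[of _ _ card])
    also have "\<dots> \<le> D + D * card Y" using less.prems(2)[OF x] Y(3) by simp
    finally have "card X \<le> D * card (insert x Y)" using c by simp
    moreover have "\<forall>u\<in>insert x Y. \<forall>v\<in>insert x Y. u \<noteq> v \<longrightarrow> \<not> R u v"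
      using Y assms(3) by blast
    ultimately show ?thesis using Y(1) x by (intro exI[of _ "insert x Y"]) auto
  qed
qed

text \<open>\<open>link u [(a\<^sub>1, w\<^sub>1), \<dots>, (a\<^sub>l, w\<^sub>l)] b v\<close> is the edge set of the bipartite walk
  \<open>u, a\<^sub>1, w\<^sub>1, \<dots>, a\<^sub>l, w\<^sub>l, b, v\<close>.\<close>
fun link :: "nat \<Rightarrow> (nat \<times> nat) list \<Rightarrow> nat \<Rightarrow> nat \<Rightarrow> (nat \<times> nat) set" where
  "link u [] b v = {(u, b), (v, b)}"
| "link u ((a, w) # ps) b v = {(u, a), (w, a)} \<union> link w ps b v"

lemma snd_link: "snd ` link u ps b v = insert b (fst ` set ps)"
  by (induction u ps b v rule: link.induct) auto

lemma finite_link: "finite (link u ps b v)"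
  by (induction u ps b v rule: link.induct) auto

lemma card_link:
  assumes "distinct (u # map snd ps @ [v])" "distinct (b # map fst ps)"
  shows "card (link u ps b v) = 2 * (length ps + 1)"
  using assms
proof (induction u ps b v rule: link.induct)
  case (2 u a w ps b v)
  have "a \<notin> snd ` link w ps b v" using 2(3) by (auto simp: snd_link)
  then have "{(u, a), (w, a)} \<inter> link w ps b v = {}" by force
  moreover have "u \<noteq> w" using 2(2) by auto
  ultimately have "card ({(u, a), (w, a)} \<union> link w ps b v) = 2 + card (link w ps b v)"
    by (subst card_Un_disjoint) (auto simp: finite_link)
  then show ?case using 2 by auto
qed auto

text \<open>The part of a walk after \<open>x\<close>, together with the edge that enters
  \<open>x\<close>, is what a shortcut through the attribute \<open>a\<close> reuses.\<close>

lemma link_append_superset: "{(x, a)} \<union> link x qs b v \<subseteq> link u (ps @ (a, x) # qs) b v"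
proof (induction ps arbitrary: u)
  case (Cons s ps)
  show ?case using Cons.IH[of "snd s"] by (cases s) auto
qed auto

text \<open>A walk enters each of its attributes from one vertex and leaves it to the next. These
  two vertices later identify the path among all paths that use the attribute.\<close>

lemma link_attribute_ends:
  assumes "distinct (u # map snd ps @ [v])" "a \<in> insert b (fst ` set ps)"
  shows "\<exists>x y. x \<noteq> y \<and> {x, y} \<subseteq> {u, v} \<union> snd ` set ps \<and> {(x, a), (y, a)} \<subseteq> link u ps b v"
  using assms
proof (induction u ps b v rule: link.induct)
  case (1 u b v)
  then show ?case by (intro exI[of _ u] exI[of _ v]) auto
next
  case (2 u a' w ps b v)
  show ?case
  proof (cases "a = a'")
    case True
    then show ?thesis using 2(2) by (intro exI[of _ u] exI[of _ w]) auto
  next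
    case False
    then obtain x y where "x \<noteq> y" "{x, y} \<subseteq> {w, v} \<union> snd ` set ps" "{(x, a), (y, a)} \<subseteq> link w ps b v"
      using 2 by auto
    then show ?thesis by (intro exI[of _ x] exI[of _ y]) auto
  qed
qed

lemma link_vertices_subset:
  assumes "link u ps b v \<subseteq> V \<times> A"
  shows "set ps \<subseteq> A \<times> V \<and> b \<in> A"
  using assms by (induction u ps b v rule: link.induct) auto

text \<open>A path that uses an attribute twice can be shortcut inside the clique of that attribute.\<close>
lemma rainbow_link_exists:
  assumes "distinct (u # xs @ [v])" "successively (ig_adj E) (u # xs @ [v])"
  shows "\<exists>ps b. link u ps b v \<subseteq> E \<and> distinct (u # map snd ps @ [v]) \<and> distinct (b # map fst ps)
      \<and> snd ` set ps \<subseteq> set xs \<and> length ps \<le> length xs"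
  using assms
proof (induction xs arbitrary: u)
  case Nil
  then obtain a where "(u, a) \<in> E" "(v, a) \<in> E" by (auto simp: ig_adj_def)
  then show ?case using Nil by (intro exI[of _ "[]"] exI[of _ a]) auto
next
  case (Cons w ys)
  then obtain ps b where IH: "link w ps b v \<subseteq> E" "distinct (w # map snd ps @ [v])"
      "distinct (b # map fst ps)" "snd ` set ps \<subseteq> set ys" "length ps \<le> length ys"
    by (auto simp: successively_Cons) metis
  obtain a where a: "(u, a) \<in> E" "(w, a) \<in> E"
    using Cons.prems by (auto simp: successively_Cons ig_adj_def)
  \<comment> \<open>If the attribute \<open>a\<close> of the first step is also the last attribute
    of the remaining walk, \<open>u\<close> joins \<open>v\<close> directly. If it leads to an inner
    vertex \<open>x\<close>, \<open>u\<close> jumps to \<open>x\<close>. Otherwise the step is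
    prepended.\<close>
  consider "a = b" | "a \<noteq> b" "a \<in> fst ` set ps" | "a \<notin> insert b (fst ` set ps)" by blast
  then show ?case
  proof cases
    case 1
    have "(v, b) \<in> link w ps b v" by (induction w ps b v rule: link.induct) auto
    then show ?thesis using 1 a IH Cons.prems by (intro exI[of _ "[]"] exI[of _ b]) auto
  next
    case 2
    then obtain x where "(a, x) \<in> set ps" by auto
    then obtain p1 p2 where ps: "ps = p1 @ (a, x) # p2" by (meson split_list)
    have "{(x, a)} \<union> link x p2 b v \<subseteq> E" using IH(1) link_append_superset[of x a p2 b v w p1] ps by auto
    moreover have "u \<notin> set (map snd ps)" using IH(4) Cons.prems by auto
    ultimately show ?thesis using a IH Cons.prems ps
      by (intro exI[of _ "(a, x) # p2"] exI[of _ b]) auto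
  next
    case 3
    moreover have "u \<notin> set (map snd ps)" using IH(4) Cons.prems by auto
    ultimately show ?thesis using a IH Cons.prems by (intro exI[of _ "(a, w) # ps"] exI[of _ b]) auto
  qed
qed

section \<open>Encoding subdivisions by bipartite edge sets\<close>

text \<open>\<open>Min\<close> and \<open>Max\<close> orient the unordered pair \<open>e\<close>, so
  that the interior data determine the walk.\<close>

definition edge_link :: "nat set \<Rightarrow> (nat \<times> nat) list \<times> nat \<Rightarrow> (nat \<times> nat) set" where
  "edge_link e d = link (Min e) (fst d) (snd d) (Max e)"

text \<open>A path with at most \<open>k + 1\<close> edges has at most \<open>k\<close> interior
  vertices. Each is paired with the attribute through which it is reached; the last component is the
  attribute leading to the end.\<close>

definition link_data :: "nat \<Rightarrow> nat \<Rightarrow> nat \<Rightarrow> ((nat \<times> nat) list \<times> nat) set" where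
  "link_data k n m = {ps. set ps \<subseteq> {0..<m} \<times> {0..<n} \<and> length ps \<le> k} \<times> {0..<m}"

text \<open>The cardinality condition says that the bipartite edges are pairwise distinct, so that a
  rainbow system is present with probability \<open>p\<close> to the number on the right.\<close>
definition rainbow_system :: "nat set set \<Rightarrow> (nat set \<Rightarrow> (nat \<times> nat) list \<times> nat) \<Rightarrow> bool" where
  "rainbow_system F g \<longleftrightarrow>
     card (\<Union>e\<in>F. edge_link e (g e)) = (\<Sum>e\<in>F. 2 * (length (fst (g e)) + 1))"

lemma finite_link_data: "finite (link_data k n m)"
  unfolding link_data_def by (intro finite_cartesian_product finite_lists_length_le) auto

lemma Min_Max_card_2:
  assumes "card (e :: nat set) = 2" "e = {x, y}"
  shows "(Min e = x \<and> Max e = y \<or> Min e = y \<and> Max e = x) \<and> x \<noteq> y"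
proof -
  have "x \<noteq> y" using assms by auto
  then show ?thesis using assms by (cases "x < y") auto
qed

lemma ig_path_link_exists:
  assumes P: "ig_path n E P" and e: "{hd P, last P} = e" "card e = 2"
    and len: "length P - 1 \<le> k + 1" and E: "E \<subseteq> {0..<n} \<times> {0..<m}"
  shows "\<exists>d\<in>link_data k n m. edge_link e d \<subseteq> E
      \<and> distinct (Min e # map snd (fst d) @ [Max e]) \<and> distinct (snd d # map fst (fst d))
      \<and> snd ` set (fst d) \<subseteq> set (butlast (tl P))"
proof -
  have ne: "hd P \<noteq> last P" using e by auto
  have "P \<noteq> []" using P by (simp add: ig_path_def)
  then obtain x Q where Q: "P = x # Q" by (cases P) auto
  with ne have "Q \<noteq> []" by auto
  define xs where "xs = butlast Q"
  have PP: "P = hd P # xs @ [last P]" using Q \<open>Q \<noteq> []\<close> by (simp add: xs_def)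
  have bt: "butlast (tl P) = xs" using Q xs_def by simp
  have lx: "length xs \<le> k" using len arg_cong[OF PP, of length] by simp
  have d: "distinct (hd P # xs @ [last P])" using P PP by (simp add: ig_path_def)
  have s: "successively (ig_adj E) (hd P # xs @ [last P])"
    using P PP by (simp add: ig_path_def successively_conv_nth)
  \<comment> \<open>The path may run from \<open>Max e\<close> to \<open>Min e\<close>; adjacency is
    symmetric, so its reversal covers this case.\<close>
  have sym: "(\<lambda>x y. ig_adj E y x) = ig_adj E" by (auto simp: ig_adj_def fun_eq_iff)
  have "successively (ig_adj E) (rev (hd P # xs @ [last P]))"
    by (simp only: successively_rev sym s)
  then have s': "successively (ig_adj E) (last P # rev xs @ [hd P])" by simp
  have d': "distinct (last P # rev xs @ [hd P])" using d by auto
  have "\<exists>ps b. link (Min e) ps b (Max e) \<subseteq> E \<and> distinct (Min e # map snd ps @ [Max e])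
      \<and> distinct (b # map fst ps) \<and> snd ` set ps \<subseteq> set xs \<and> length ps \<le> length xs"
    using Min_Max_card_2[OF e(2) e(1)[symmetric]] rainbow_link_exists[OF d s] rainbow_link_exists[OF d' s']
    by (elim conjE disjE) (simp_all only: set_rev length_rev)
  then obtain ps b where *: "link (Min e) ps b (Max e) \<subseteq> E" "distinct (Min e # map snd ps @ [Max e])"
      "distinct (b # map fst ps)" "snd ` set ps \<subseteq> set xs" "length ps \<le> length xs" by blast
  have "set ps \<subseteq> {0..<m} \<times> {0..<n} \<and> b \<in> {0..<m}"
    by (rule link_vertices_subset) (use * E in blast)
  then show ?thesis using * lx bt
    by (intro bexI[of _ "(ps, b)"]) (auto simp: link_data_def edge_link_def)
qed

text \<open>Walks with disjoint attribute sets share no bipartite edge, and within one walk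
  \<open>card_link\<close> gives the number of edges.\<close>

lemma rainbow_systemI:
  assumes "finite F"
    and "\<And>e. e \<in> F \<Longrightarrow> distinct (Min e # map snd (fst (g e)) @ [Max e]) \<and> distinct (snd (g e) # map fst (fst (g e)))"
    and "\<And>e e'. e \<in> F \<Longrightarrow> e' \<in> F \<Longrightarrow> e \<noteq> e' \<Longrightarrow>
      snd ` edge_link e (g e) \<inter> snd ` edge_link e' (g e') = {}"
  shows "rainbow_system F g"
proof -
  have "card (\<Union>e\<in>F. edge_link e (g e)) = (\<Sum>e\<in>F. card (edge_link e (g e)))"
  proof (rule card_UN_disjoint)
    show "\<forall>e\<in>F. \<forall>e'\<in>F. e \<noteq> e' \<longrightarrow> edge_link e (g e) \<inter> edge_link e' (g e') = {}"
      using assms(3) by blast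
  qed (auto simp: assms(1) edge_link_def finite_link)
  also have "\<dots> = (\<Sum>e\<in>F. 2 * (length (fst (g e)) + 1))"
    unfolding edge_link_def by (intro sum.cong card_link) (use assms(2) in auto)
  finally show ?thesis by (simp add: rainbow_system_def)
qed

text \<open>An edge of a path determines the path, so an attribute with at most s neighbours is used by
  at most \<open>2 ^ s\<close> of the paths.\<close>
lemma shallow_top_minor_rainbow_system:
  assumes minor: "shallow_top_minor k VH EH n E" and E: "E \<subseteq> {0..<n} \<times> {0..<m}"
    and attr: "\<And>a. card {v. (v, a) \<in> E} \<le> s"
  shows "\<exists>S F g. S \<subseteq> {0..<n} \<and> card S = card VH \<and> F \<subseteq> {e. e \<subseteq> S \<and> card e = 2} \<and>
      card EH \<le> (k + 1) * 2 ^ s * card F \<and> (\<forall>F'\<subseteq>F. rainbow_system F' g) \<and>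
      (\<forall>e\<in>F. g e \<in> link_data k n m \<and> edge_link e (g e) \<subseteq> E)"
proof -
  obtain phi path where inj: "inj_on phi VH" and rng: "phi ` VH \<subseteq> {0..<n}" 
    and path: "\<And>e. e \<in> EH \<Longrightarrow> ig_path n E (path e) \<and> {hd (path e), last (path e)} = phi ` e \<and>
                 length (path e) - 1 \<le> k + 1 \<and> set (butlast (tl (path e))) \<inter> phi ` VH = {}"
    and disj: "\<And>e e'. e \<in> EH \<Longrightarrow> e' \<in> EH \<Longrightarrow> e \<noteq> e' \<Longrightarrow>
                 set (butlast (tl (path e))) \<inter> set (butlast (tl (path e'))) = {}"
    using minor unfolding shallow_top_minor_def by metis
  have sg: "finite VH" "\<And>e. e \<in> EH \<Longrightarrow> e \<subseteq> VH \<and> card e = 2"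
    using minor unfolding shallow_top_minor_def simple_graph_def by auto
  define S where "S = phi ` VH"
  \<comment> \<open>Edges are moved to pairs of branch vertices of the host graph;
    \<open>\<iota>\<close> recovers the original edge, and \<open>I\<close> is the interior of its
    path.\<close>
  define F0 where "F0 = image phi ` EH"
  define \<iota> where "\<iota> = inv_into EH (image phi)"
  define I where "I e = set (butlast (tl (path (\<iota> e))))" for e
  have injI: "inj_on (image phi) EH"
    by (rule inj_on_subset[OF inj_on_image_Pow[OF inj]]) (use sg in auto)
  have finEH: "finite EH" by (rule finite_subset[of _ "Pow VH"]) (use sg in auto)
  have finF0: "finite F0" and cF0: "card F0 = card EH"
    using finEH injI by (auto simp: F0_def card_image)
  have \<iota>: "\<iota> e \<in> EH" "phi ` (\<iota> e) = e" if "e \<in> F0" for e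
    using that inv_into_into[of e "image phi" EH] f_inv_into_f[of e "image phi" EH]
    unfolding F0_def \<iota>_def by blast+
  have F0S: "F0 \<subseteq> {e. e \<subseteq> S \<and> card e = 2}"
    unfolding F0_def S_def using sg inj by (auto intro: card_image[THEN trans] inj_on_subset)
  have IS: "I e \<inter> S = {}" if "e \<in> F0" for e
    using path[OF \<iota>(1)[OF that]] by (simp add: I_def S_def)
  have II: "I e \<inter> I e' = {}" if "e \<in> F0" "e' \<in> F0" "e \<noteq> e'" for e e'
    using disj[OF \<iota>(1)[OF that(1)] \<iota>(1)[OF that(2)]] \<iota>(2)[OF that(1)] \<iota>(2)[OF that(2)] that(3)
    unfolding I_def by metis
  have "\<forall>e\<in>F0. \<exists>d. d \<in> link_data k n m \<and> edge_link e d \<subseteq> E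
      \<and> distinct (Min e # map snd (fst d) @ [Max e]) \<and> distinct (snd d # map fst (fst d))
      \<and> snd ` set (fst d) \<subseteq> I e"
  proof
    fix e assume e: "e \<in> F0"
    have "card e = 2" using e F0S by auto
    show "\<exists>d. d \<in> link_data k n m \<and> edge_link e d \<subseteq> E
      \<and> distinct (Min e # map snd (fst d) @ [Max e]) \<and> distinct (snd d # map fst (fst d))
      \<and> snd ` set (fst d) \<subseteq> I e"
      unfolding I_def Bex_def[symmetric]
      by (rule ig_path_link_exists) (use path[OF \<iota>(1)[OF e]] \<iota>(2)[OF e] E \<open>card e = 2\<close> in auto)
  qed
  then obtain g where g: "\<And>e. e \<in> F0 \<Longrightarrow> g e \<in> link_data k n m \<and> edge_link e (g e) \<subseteq> E
      \<and> distinct (Min e # map snd (fst (g e)) @ [Max e]) \<and> distinct (snd (g e) # map fst (fst (g e)))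
      \<and> snd ` set (fst (g e)) \<subseteq> I e"
    by metis
  define A where "A e = snd ` edge_link e (g e)" for e
  have A: "A e = insert (snd (g e)) (fst ` set (fst (g e)))" for e
    by (simp add: A_def edge_link_def snd_link)
  have cA: "finite (A e) \<and> card (A e) \<le> k + 1" if "e \<in> F0" for e
  proof -
    have "card (A e) \<le> card (set (snd (g e) # map fst (fst (g e))))" by (simp add: A)
    also have "\<dots> \<le> length (snd (g e) # map fst (fst (g e)))" by (rule card_length)
    also have "\<dots> \<le> k + 1" using g[OF that] by (auto simp: link_data_def)
    finally show ?thesis by (simp add: A)
  qed
  have multi: "card {e \<in> F0. a \<in> A e} \<le> 2 ^ s" for a
  proof -
    let ?N = "{v. (v, a) \<in> E}"
    \<comment> \<open>The neighbours of \<open>a\<close> on the path of \<open>e\<close>.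
      Injectivity of \<open>?h\<close> bounds the number of paths through \<open>a\<close> by the
      number of subsets of \<open>?N\<close>.\<close>
    let ?h = "\<lambda>e. (e \<union> I e) \<inter> ?N"
    have finN: "finite ?N" by (rule finite_subset[of _ "{0..<n}"]) (use E in auto)
    have two: "\<exists>x y. x \<noteq> y \<and> {x, y} \<subseteq> ?h e" if e: "e \<in> F0" "a \<in> A e" for e
    proof -
      have "card e = 2" using F0S e(1) by auto
      then have "finite e" "e \<noteq> {}" by (auto intro: card_ge_0_finite)
      then have mm: "Min e \<in> e" "Max e \<in> e" by auto
      obtain x y where "x \<noteq> y" "{x, y} \<subseteq> {Min e, Max e} \<union> snd ` set (fst (g e))"
          "{(x, a), (y, a)} \<subseteq> edge_link e (g e)"
        unfolding edge_link_def
        using link_attribute_ends[of "Min e" "fst (g e)" "Max e" a "snd (g e)"] g[OF e(1)] e(2) A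
        by metis
      then show ?thesis using g[OF e(1)] mm by (intro exI[of _ x] exI[of _ y]) auto
    qed
    have "inj_on ?h {e \<in> F0. a \<in> A e}"
    proof (rule inj_onI, rule ccontr)
      fix e e' assume *: "e \<in> {e \<in> F0. a \<in> A e}" "e' \<in> {e \<in> F0. a \<in> A e}" "?h e = ?h e'" "e \<noteq> e'"
      obtain x y where xy: "x \<noteq> y" "{x, y} \<subseteq> ?h e" using two * by blast
      then have xy': "{x, y} \<subseteq> ?h e'" using * by simp
      have eS: "e \<subseteq> S" "card e = 2" "e' \<subseteq> S" "card e' = 2" using F0S * by auto
      have dj: "I e \<inter> S = {}" "I e' \<inter> S = {}" "I e \<inter> I e' = {}"
        using IS II * by auto
      \<comment> \<open>Different paths meet only in common branch vertices, so two shared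
        neighbours of \<open>a\<close> are both ends of \<open>e\<close> and of \<open>e'\<close>,
        forcing \<open>e = e'\<close>.\<close>
      have both: "z \<in> e \<and> z \<in> e'" if "z \<in> e \<union> I e" "z \<in> e' \<union> I e'" for z
        using that dj eS(1,3) by auto
      have "{x, y} \<subseteq> e \<and> {x, y} \<subseteq> e'"
        using both[of x] both[of y] xy(2) xy' by simp
      moreover have "finite e" "finite e'" using eS by (auto intro: card_ge_0_finite)
      ultimately have "{x, y} = e" "{x, y} = e'" using eS xy(1) by (simp_all add: card_subset_eq)
      then show False using * by simp
    qed
    then have "card {e \<in> F0. a \<in> A e} \<le> card (Pow ?N)"
      using finN by (intro card_inj_on_le[of ?h]) auto
    also have "\<dots> \<le> 2 ^ s" using attr[of a] finN by (simp add: card_Pow)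
    finally show ?thesis .
  qed
  \<comment> \<open>The conflict relation for the greedy choice. A path has at most
    \<open>k + 1\<close> attributes, each on at most \<open>2 ^ s\<close> paths; as
    \<open>A e\<close> is nonempty, this count includes \<open>e\<close> itself.\<close>
  let ?R = "\<lambda>e e'. e = e' \<or> A e \<inter> A e' \<noteq> {}"
  have "card {e' \<in> F0. ?R e e'} \<le> (k + 1) * 2 ^ s" if "e \<in> F0" for e
  proof -
    have "{e' \<in> F0. ?R e e'} \<subseteq> (\<Union>a\<in>A e. {e' \<in> F0. a \<in> A e'})" using A by auto
    then have "card {e' \<in> F0. ?R e e'} \<le> card (\<Union>a\<in>A e. {e' \<in> F0. a \<in> A e'})"
      using finF0 cA[OF that] by (intro card_mono) auto
    also have "\<dots> \<le> (\<Sum>a\<in>A e. card {e' \<in> F0. a \<in> A e'})"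
      using cA[OF that] by (intro card_UN_le) auto
    also have "\<dots> \<le> (\<Sum>a\<in>A e. 2 ^ s)" by (intro sum_mono multi)
    also have "\<dots> \<le> (k + 1) * 2 ^ s" using cA[OF that] by (simp only: sum_constant of_nat_id mult_le_mono1)
    finally show ?thesis .
  qed
  then obtain F where F: "F \<subseteq> F0" "\<forall>x\<in>F. \<forall>y\<in>F. x \<noteq> y \<longrightarrow> \<not> ?R x y"
      "card F0 \<le> (k + 1) * 2 ^ s * card F"
    using pairwise_unrelated_subset[of F0 ?R "(k + 1) * 2 ^ s"] finF0 by blast
  \<comment> \<open>All subsets are treated because \<open>F\<close> is later cut down to an exact
    size.\<close>
  have "rainbow_system F' g" if "F' \<subseteq> F" for F'
  proof (rule rainbow_systemI)
    show "finite F'" using that F(1) finF0 by (meson finite_subset)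
    show "distinct (Min e # map snd (fst (g e)) @ [Max e]) \<and> distinct (snd (g e) # map fst (fst (g e)))"
      if "e \<in> F'" for e using g[of e] that \<open>F' \<subseteq> F\<close> F(1) by blast
    show "snd ` edge_link e (g e) \<inter> snd ` edge_link e' (g e') = {}"
      if "e \<in> F'" "e' \<in> F'" "e \<noteq> e'" for e e'
      using F(2) that \<open>F' \<subseteq> F\<close> unfolding A_def by blast
  qed
  moreover have "card S = card VH" using inj by (simp add: S_def card_image)
  moreover have "\<forall>e\<in>F. g e \<in> link_data k n m \<and> edge_link e (g e) \<subseteq> E" using g F(1) by blast
  moreover have "F \<subseteq> {e. e \<subseteq> S \<and> card e = 2}" using F(1) F0S by blast
  moreover have "card EH \<le> (k + 1) * 2 ^ s * card F" using F(3) cF0 by simp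
  ultimately show ?thesis using rng
    by (intro exI[of _ S] exI[of _ F] exI[of _ g]) (unfold S_def, blast)
qed

section \<open>First moment of rainbow systems\<close>

text \<open>The factor that one path contributes to the union bound, grouped by the number
  \<open>l\<close> of interior vertices.\<close>

lemma sum_link_data_weight:
  "(\<Sum>d\<in>link_data k n m. (p :: real) ^ (2 * (length (fst d) + 1))) =
    (\<Sum>l\<le>k. (real m * real n) ^ l * real m * p ^ (2 * (l + 1)))"
proof -
  let ?X = "{0..<m} \<times> {0..<n}"
  have split: "{ps. set ps \<subseteq> ?X \<and> length ps \<le> k} = (\<Union>l\<in>{..k}. {ps. set ps \<subseteq> ?X \<and> length ps = l})"
    by auto
  have "(\<Sum>d\<in>link_data k n m. p ^ (2 * (length (fst d) + 1))) =
      (\<Sum>ps\<in>{ps. set ps \<subseteq> ?X \<and> length ps \<le> k}. \<Sum>b\<in>{0..<m}. p ^ (2 * (length ps + 1)))"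
    unfolding link_data_def by (subst sum.cartesian_product) (simp add: case_prod_unfold)
  also have "\<dots> = (\<Sum>l\<le>k. \<Sum>ps\<in>{ps. set ps \<subseteq> ?X \<and> length ps = l}. real m * p ^ (2 * (length ps + 1)))"
    unfolding split by (subst sum.UNION_disjoint) (auto intro: finite_lists_length_eq)
  also have "\<dots> = (\<Sum>l\<le>k. \<Sum>ps\<in>{ps. set ps \<subseteq> ?X \<and> length ps = l}. real m * p ^ (2 * (l + 1)))"
    by (intro sum.cong) auto
  also have "\<dots> = (\<Sum>l\<le>k. (real m * real n) ^ l * real m * p ^ (2 * (l + 1)))"
    by (intro sum.cong) (simp_all add: card_lists_length_eq card_cartesian_product)
  finally show ?thesis .
qed

text \<open>For a rainbow \<open>g\<close> the number of bipartite edges is the sum over the walks,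
  so the probability is at most a product of single-walk weights. The sum of these products over all
  \<open>g\<close> factorises over \<open>F\<close>.\<close>

lemma rbg_prob_rainbow_system:
  assumes p: "0 \<le> p" "p \<le> 1" and F: "finite F"
    and W: "(\<Sum>d\<in>link_data k n m. p ^ (2 * (length (fst d) + 1))) \<le> W"
  shows "rbg_prob n m p (\<lambda>E. \<exists>g\<in>PiE F (\<lambda>_. link_data k n m).
      rainbow_system F g \<and> (\<Union>e\<in>F. edge_link e (g e)) \<subseteq> E) \<le> W ^ card F"
proof -
  let ?G = "PiE F (\<lambda>_. link_data k n m)"
  let ?w = "\<lambda>d :: (nat \<times> nat) list \<times> nat. p ^ (2 * (length (fst d) + 1))"
  have "rbg_prob n m p (\<lambda>E. \<exists>g\<in>?G. rainbow_system F g \<and> (\<Union>e\<in>F. edge_link e (g e)) \<subseteq> E) \<le>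
      (\<Sum>g\<in>?G. rbg_prob n m p (\<lambda>E. rainbow_system F g \<and> (\<Union>e\<in>F. edge_link e (g e)) \<subseteq> E))"
    by (rule rbg_prob_Bex_le[OF p]) (use F finite_link_data in \<open>auto intro: finite_PiE\<close>)
  also have "\<dots> \<le> (\<Sum>g\<in>?G. \<Prod>e\<in>F. ?w (g e))"
  proof (rule sum_mono)
    fix g
    have nonneg: "(\<Prod>e\<in>F. ?w (g e)) \<ge> 0" using p by (intro prod_nonneg) auto
    show "rbg_prob n m p (\<lambda>E. rainbow_system F g \<and> (\<Union>e\<in>F. edge_link e (g e)) \<subseteq> E) \<le> (\<Prod>e\<in>F. ?w (g e))"
    proof (cases "rainbow_system F g")
      case True
      have "rbg_prob n m p (\<lambda>E. (\<Union>e\<in>F. edge_link e (g e)) \<subseteq> E) \<le>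
          p ^ (\<Sum>e\<in>F. 2 * (length (fst (g e)) + 1))"
        using rbg_prob_superset_le[OF p, of n m "\<Union>e\<in>F. edge_link e (g e)"] True
        by (simp only: rainbow_system_def)
      then show ?thesis using True by (simp add: power_sum)
    next
      case False
      then show ?thesis using nonneg by (simp add: rbg_prob_def)
    qed
  qed
  also have "\<dots> = (\<Prod>e\<in>F. \<Sum>d\<in>link_data k n m. ?w d)"
    using F finite_link_data by (simp only: prod_sum_PiE)
  also have "\<dots> = (\<Sum>d\<in>link_data k n m. ?w d) ^ card F" by simp
  also have "\<dots> \<le> W ^ card F" using W p by (intro power_mono sum_nonneg) auto
  finally show ?thesis .
qed

text \<open>The event to be excluded. Exact sizes and extensional functions \<open>g\<close> make it
  a union over finite index sets.\<close>

definition dense_rainbow :: "nat \<Rightarrow> nat \<Rightarrow> nat \<Rightarrow> nat \<Rightarrow> nat \<Rightarrow> (nat \<times> nat) set \<Rightarrow> bool" where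
  "dense_rainbow k n m h q E \<longleftrightarrow>
     (\<exists>S\<in>{S. S \<subseteq> {0..<n} \<and> card S = h}. \<exists>F\<in>{F. F \<subseteq> {e. e \<subseteq> S \<and> card e = 2} \<and> card F = q}.
        \<exists>g\<in>PiE F (\<lambda>_. link_data k n m). rainbow_system F g \<and> (\<Union>e\<in>F. edge_link e (g e)) \<subseteq> E)"

lemma rbg_prob_dense_rainbow:
  assumes p: "0 \<le> p" "p \<le> 1"
    and W: "(\<Sum>d\<in>link_data k n m. p ^ (2 * (length (fst d) + 1))) \<le> W"
  shows "rbg_prob n m p (dense_rainbow k n m h q) \<le>
    real (n choose h) * (real ((h choose 2) choose q) * W ^ q)"
proof -
  have fS: "finite {S. S \<subseteq> {0..<n} \<and> card S = h}" by simp
  have "rbg_prob n m p (dense_rainbow k n m h q) \<le>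
     (\<Sum>S\<in>{S. S \<subseteq> {0..<n} \<and> card S = h}. rbg_prob n m p (\<lambda>E.
        \<exists>F\<in>{F. F \<subseteq> {e. e \<subseteq> S \<and> card e = 2} \<and> card F = q}. \<exists>g\<in>PiE F (\<lambda>_. link_data k n m).
          rainbow_system F g \<and> (\<Union>e\<in>F. edge_link e (g e)) \<subseteq> E))"
    unfolding dense_rainbow_def by (rule rbg_prob_Bex_le[OF p fS])
  also have "\<dots> \<le> (\<Sum>S\<in>{S. S \<subseteq> {0..<n} \<and> card S = h}. real ((h choose 2) choose q) * W ^ q)"
  proof (rule sum_mono)
    fix S assume S: "S \<in> {S. S \<subseteq> {0..<n} \<and> card S = h}"
    then have finS: "finite S" using finite_subset by auto
    let ?P = "{e. e \<subseteq> S \<and> card e = 2}"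
    let ?FF = "{F. F \<subseteq> ?P \<and> card F = q}"
    have finP: "finite ?P" using finS by simp
    then have fF: "finite ?FF" by simp
    have "rbg_prob n m p (\<lambda>E. \<exists>F\<in>?FF. \<exists>g\<in>PiE F (\<lambda>_. link_data k n m).
          rainbow_system F g \<and> (\<Union>e\<in>F. edge_link e (g e)) \<subseteq> E) \<le>
      (\<Sum>F\<in>?FF. rbg_prob n m p (\<lambda>E. \<exists>g\<in>PiE F (\<lambda>_. link_data k n m).
          rainbow_system F g \<and> (\<Union>e\<in>F. edge_link e (g e)) \<subseteq> E))"
      by (rule rbg_prob_Bex_le[OF p fF])
    also have "\<dots> \<le> (\<Sum>F\<in>?FF. W ^ q)"
    proof (rule sum_mono)
      fix F assume "F \<in> ?FF"
      moreover from this have "finite F" using finP finite_subset by blast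
      ultimately show "rbg_prob n m p (\<lambda>E. \<exists>g\<in>PiE F (\<lambda>_. link_data k n m).
          rainbow_system F g \<and> (\<Union>e\<in>F. edge_link e (g e)) \<subseteq> E) \<le> W ^ q"
        using rbg_prob_rainbow_system[OF p _ W, of F] by simp
    qed
    also have "\<dots> = real ((h choose 2) choose q) * W ^ q"
      using S finS n_subsets[OF finP, of q] n_subsets[OF finS, of 2] by simp
    finally show "rbg_prob n m p (\<lambda>E. \<exists>F\<in>?FF. \<exists>g\<in>PiE F (\<lambda>_. link_data k n m).
          rainbow_system F g \<and> (\<Union>e\<in>F. edge_link e (g e)) \<subseteq> E) \<le> real ((h choose 2) choose q) * W ^ q" .
  qed
  also have "\<dots> = real (n choose h) * (real ((h choose 2) choose q) * W ^ q)"
    by (simp add: n_subsets)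
  finally show ?thesis .
qed

section \<open>From sparse rainbow systems to the density of minors\<close>

lemma top_grad_le:
  assumes n: "0 < n" and E: "E \<subseteq> {0..<n} \<times> {0..<m}"
    and attr: "\<And>a. card {v. (v, a) \<in> E} \<le> s"
    and sparse: "\<And>h. h \<in> {1..n} \<Longrightarrow> \<not> dense_rainbow k n m h (f * h) E"
  shows "top_grad k n E \<le> real ((k + 1) * 2 ^ s * f)"
  unfolding top_grad_def
proof (rule cSup_least)
  \<comment> \<open>A single vertex is a minor, so the supremum is over a nonempty set.\<close>
  have "shallow_top_minor k {0} {} n E"
    unfolding shallow_top_minor_def simple_graph_def using n by (auto intro: exI[of _ id])
  then show "{real (card EH) / real (card VH) |VH EH. VH \<noteq> {} \<and> shallow_top_minor k VH EH n E} \<noteq> {}"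
    by blast
next
  fix x assume "x \<in> {real (card EH) / real (card VH) |VH EH. VH \<noteq> {} \<and> shallow_top_minor k VH EH n E}"
  then obtain VH EH where x: "x = real (card EH) / real (card VH)" and ne: "VH \<noteq> {}"
    and minor: "shallow_top_minor k VH EH n E" by auto
  obtain S F g where S: "S \<subseteq> {0..<n}" "card S = card VH" and F: "F \<subseteq> {e. e \<subseteq> S \<and> card e = 2}"
    and cE: "card EH \<le> (k + 1) * 2 ^ s * card F" and rb: "\<forall>F'\<subseteq>F. rainbow_system F' g"
    and g: "\<forall>e\<in>F. g e \<in> link_data k n m \<and> edge_link e (g e) \<subseteq> E"
    using shallow_top_minor_rainbow_system[OF minor E attr] by (elim exE conjE) (rule that)
  have "finite VH" using minor unfolding shallow_top_minor_def simple_graph_def by auto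
  then have pos: "0 < card VH" using ne by (simp add: card_gt_0_iff)
  moreover have "card VH \<le> n" using card_mono[OF _ S(1)] S(2) by simp
  ultimately have h: "card VH \<in> {1..n}" by auto
  \<comment> \<open>Otherwise exactly \<open>f * card VH\<close> of the paths, with \<open>g\<close>
    restricted to them to become extensional, form an excluded dense system.\<close>
  have "card F < f * card VH"
  proof (rule ccontr)
    assume "\<not> card F < f * card VH"
    then obtain F' where F': "F' \<subseteq> F" "card F' = f * card VH"
      using obtain_subset_with_card_n[of "f * card VH" F] by (auto simp: not_less)
    let ?g = "restrict g F'"
    have "rainbow_system F' ?g \<longleftrightarrow> rainbow_system F' g" unfolding rainbow_system_def by simp
    then have "rainbow_system F' ?g" using rb F'(1) by blast
    moreover have "?g \<in> PiE F' (\<lambda>_. link_data k n m)" using g F' by auto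
    moreover have "(\<Union>e\<in>F'. edge_link e (?g e)) \<subseteq> E" using g F'(1) by auto
    moreover have "F' \<in> {F. F \<subseteq> {e. e \<subseteq> S \<and> card e = 2} \<and> card F = f * card VH}"
      using F F' by auto
    moreover have "S \<in> {S. S \<subseteq> {0..<n} \<and> card S = card VH}" using S by simp
    ultimately have "dense_rainbow k n m (card VH) (f * card VH) E"
      unfolding dense_rainbow_def by (intro bexI conjI)
    then show False using sparse[OF h] by simp
  qed
  then have "card EH \<le> (k + 1) * 2 ^ s * (f * card VH)"
    using cE by (meson less_imp_le_nat mult_le_mono2 order_trans)
  then have "real (card EH) \<le> real ((k + 1) * 2 ^ s * (f * card VH))" by (rule of_nat_mono)
  then show "x \<le> real ((k + 1) * 2 ^ s * f)"
    using pos unfolding x by (simp add: field_simps)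
qed

subsection \<open>Counting\<close>

lemma power_div_fact_le_exp:
  fixes x :: real
  assumes "0 \<le> x"
  shows "x ^ j / fact j \<le> exp x"
proof -
  have "sum (\<lambda>i. x ^ i /\<^sub>R fact i) {j} \<le> exp x"
    using exp_converges[of x] assms
    by (intro sum_le_suminf[THEN order_trans, OF sums_summable, OF exp_converges[of x]])
       (auto simp: sums_iff)
  then show ?thesis by (simp add: field_simps)
qed

text \<open>Combines \<open>N choose j \<le> N ^ j / fact j\<close> with
  \<open>j ^ j / fact j \<le> exp j\<close>.\<close>

lemma binomial_le_exp_pow:
  assumes "0 < j"
  shows "real (N choose j) \<le> (exp 1 * real N / real j) ^ j"
proof -
  have "real ((N choose j) * fact j) \<le> real (N ^ j)" by (rule of_nat_mono[OF binomial_fact_pow])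
  then have "real (N choose j) \<le> real N ^ j / fact j" by (simp add: field_simps)
  also have "\<dots> = (real N / real j) ^ j * (real j ^ j / fact j)"
    using assms by (simp add: field_simps)
  also have "\<dots> \<le> (real N / real j) ^ j * exp (real j)"
    by (intro mult_left_mono power_div_fact_le_exp) auto
  also have "exp (real j) = exp 1 ^ j" by (simp add: exp_of_nat_mult[symmetric])
  finally show ?thesis by (simp add: power_mult_distrib[symmetric] mult_ac)
qed

text \<open>With \<open>x = h / n\<close> and \<open>y = e * K / f\<close>, the binomial estimates
  bound the left side by \<open>(e / x * (y * x) ^ f) ^ h\<close>. The choice of \<open>f\<close>
  makes \<open>2 * e * y \<le> 1\<close>, which brings this down to
  \<open>(x / 4) ^ h\<close>.\<close>

lemma dense_count_bound:
  assumes h: "1 \<le> h" "h \<le> n" and K: "0 \<le> K" and f: "2 \<le> f" "2 * exp 1 * exp 1 * K \<le> real f"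
  shows "real (n choose h) * (real ((h choose 2) choose (f * h)) * (K / real n) ^ (f * h))
    \<le> (1 / 2) ^ h / real n"
proof -
  define e :: real where "e = exp 1"
  define x where "x = real h / real n"
  define y where "y = e * K / real f"
  have e: "1 \<le> e" by (simp add: e_def)
  have x: "0 < x" "x \<le> 1" using h by (auto simp: x_def)
  have y: "0 \<le> y" using K e by (simp add: y_def)
  have ey: "2 * e * y \<le> 1" using f by (simp add: y_def e_def field_simps)
  have y1: "y \<le> 1" using ey y e mult_right_mono[of 1 "2 * e" y] by simp
  have q: "0 < f * h" using f h by simp
  have "real (h choose 2) \<le> real h * real h"
  proof -
    have "h choose 2 \<le> h * h" by (simp add: choose_two) (metis div_le_dividend diff_le_self le_trans mult_le_mono2)
    then have "real (h choose 2) \<le> real (h * h)" by (rule of_nat_mono)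
    then show ?thesis by simp
  qed
  then have "e * real (h choose 2) / real (f * h) \<le> e * (real h * real h) / real (f * h)"
    using e by (intro divide_right_mono mult_left_mono) auto
  also have "\<dots> = e * real h / real f" using h f by (simp add: field_simps)
  finally have base: "e * real (h choose 2) / real (f * h) \<le> e * real h / real f" .
  have "real ((h choose 2) choose (f * h)) \<le> (e * real (h choose 2) / real (f * h)) ^ (f * h)"
    unfolding e_def by (rule binomial_le_exp_pow[OF q])
  also have "\<dots> \<le> (e * real h / real f) ^ (f * h)"
    using base e by (intro power_mono) auto
  finally have c2: "real ((h choose 2) choose (f * h)) \<le> (e * real h / real f) ^ (f * h)" .
  have c1: "real (n choose h) \<le> (e / x) ^ h"
    using binomial_le_exp_pow[of h n] h by (simp add: e_def x_def)
  have "real (n choose h) * (real ((h choose 2) choose (f * h)) * (K / real n) ^ (f * h))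
      \<le> (e / x) ^ h * ((e * real h / real f) ^ (f * h) * (K / real n) ^ (f * h))"
    using c1 c2 K e x by (intro mult_mono mult_right_mono) auto
  also have "(e * real h / real f) ^ (f * h) * (K / real n) ^ (f * h) = ((y * x) ^ f) ^ h"
    by (simp add: power_mult_distrib[symmetric] power_mult[symmetric] x_def y_def mult_ac)
  also have "(e / x) ^ h * ((y * x) ^ f) ^ h = (e / x * (y * x) ^ f) ^ h"
    by (simp only: power_mult_distrib)
  also have "\<dots> \<le> (x / 4) ^ h"
  proof (rule power_mono)
    \<comment> \<open>Of the two factors \<open>x\<close>, one cancels \<open>1 / x\<close> and the
      other is left to produce the decay in \<open>n\<close>.\<close>
    have "(y * x) ^ f \<le> (y * x) ^ 2"
      using x y y1 f by (intro power_decreasing) (auto intro: mult_le_one)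
    then have "e / x * (y * x) ^ f \<le> e / x * (y * x) ^ 2"
      using e x by (intro mult_left_mono) auto
    also have "\<dots> = e * y * y * x" using x by (simp add: power2_eq_square field_simps)
    also have "\<dots> \<le> 1 / 4 * x"
    proof (rule mult_right_mono)
      have "y \<le> e * y" using e y mult_right_mono[of 1 e y] by simp
      then have "e * y * y \<le> (1 / 2) * (1 / 2)"
        using ey y e by (intro mult_mono) auto
      then show "e * y * y \<le> 1 / 4" by simp
    qed (use x in auto)
    finally show "e / x * (y * x) ^ f \<le> x / 4" by simp
    show "0 \<le> e / x * (y * x) ^ f" using e x y by auto
  qed
  also have "(x / 4) ^ h = x ^ h * (1 / 4) ^ h" by (simp add: power_divide)
  \<comment> \<open>Keeping a single \<open>x = h / n\<close> supplies the factor
    \<open>1 / n\<close>; its numerator is absorbed by \<open>h \<le> 2 ^ h\<close>.\<close>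
  also have "\<dots> \<le> x * (1 / 4) ^ h"
    using power_decreasing[of 1 h x] x h by (intro mult_right_mono) auto
  also have "\<dots> = real h * (1 / 4) ^ h / real n" by (simp add: x_def)
  also have "\<dots> \<le> 2 ^ h * (1 / 4) ^ h / real n"
    using less_exp[of h] by (intro divide_right_mono mult_right_mono) (auto simp: less_imp_le of_nat_less_numeral_power_cancel_iff)
  also have "(2 :: real) ^ h * (1 / 4) ^ h = (1 / 2) ^ h"
    by (simp add: power_mult_distrib[symmetric])
  finally show ?thesis .
qed

lemma sum_half_powers: "(\<Sum>h = 1..n. (1 / 2 :: real) ^ h) = 1 - (1 / 2) ^ n"
  by (induction n) (auto simp: field_simps)

section \<open>Bounding the failure probability\<close>

text \<open>Each summand of the single-walk weight equals
  \<open>(m * n * p ^ 2) ^ (l + 1) / n\<close>, so the weight is at most \<open>K / n\<close> with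
  \<open>K\<close> a constant. The bounds over \<open>h\<close> then form a geometric
  series.\<close>

lemma rbg_prob_dense_rainbow_le:
  assumes p: "0 \<le> p" "p \<le> 1" and n: "0 < n" and c: "real m * real n * p\<^sup>2 \<le> c"
    and f: "2 \<le> f" "2 * exp 1 * exp 1 * (\<Sum>l\<le>k. c ^ (l + 1)) \<le> real f"
  shows "rbg_prob n m p (\<lambda>E. \<exists>h\<in>{1..n}. dense_rainbow k n m h (f * h) E) \<le> 1 / real n"
proof -
  let ?K = "\<Sum>l\<le>k. c ^ (l + 1)"
  have c0: "0 \<le> c" using c by (rule order_trans[rotated]) auto
  have "(\<Sum>d\<in>link_data k n m. p ^ (2 * (length (fst d) + 1))) =
      (\<Sum>l\<le>k. (real m * real n * p\<^sup>2) ^ (l + 1)) / real n"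
    unfolding sum_link_data_weight sum_divide_distrib
    using n by (intro sum.cong) (auto simp: power_mult_distrib power_mult power2_eq_square)
  also have "\<dots> \<le> ?K / real n"
    using c by (intro divide_right_mono sum_mono power_mono) auto
  finally have W: "(\<Sum>d\<in>link_data k n m. p ^ (2 * (length (fst d) + 1))) \<le> ?K / real n" .
  have K: "0 \<le> ?K" using c0 by (intro sum_nonneg) auto
  have "rbg_prob n m p (\<lambda>E. \<exists>h\<in>{1..n}. dense_rainbow k n m h (f * h) E) \<le>
      (\<Sum>h = 1..n. rbg_prob n m p (dense_rainbow k n m h (f * h)))"
    by (rule rbg_prob_Bex_le[OF p]) simp
  also have "\<dots> \<le> (\<Sum>h = 1..n. (1 / 2) ^ h / real n)"
    by (intro sum_mono order_trans[OF rbg_prob_dense_rainbow[OF p W] dense_count_bound[OF _ _ K f]]) auto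
  also have "\<dots> = (1 - (1 / 2) ^ n) / real n"
    by (simp only: sum_divide_distrib[symmetric] sum_half_powers)
  also have "\<dots> \<le> 1 / real n" by (intro divide_right_mono) auto
  finally show ?thesis .
qed

text \<open>Outside two bad events \<open>top_grad_le\<close> applies: an attribute with
  \<open>Suc s\<close> neighbours, and a dense rainbow system for some \<open>h\<close>.\<close>

lemma rbg_prob_top_grad_ge:
  assumes p: "0 \<le> p" "p \<le> 1" and n: "0 < n" and c: "real m * real n * p\<^sup>2 \<le> c"
    and f: "2 \<le> f" "2 * exp 1 * exp 1 * (\<Sum>l\<le>k. c ^ (l + 1)) \<le> real f"
  shows "1 - (real m * (real n * p) ^ Suc s + 1 / real n) \<le>
    rbg_prob n m p (\<lambda>E. top_grad k n E \<le> real ((k + 1) * 2 ^ s * f))"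
proof -
  let ?Q = "\<lambda>E. top_grad k n E \<le> real ((k + 1) * 2 ^ s * f)"
  let ?A = "\<lambda>E :: (nat \<times> nat) set. \<exists>a. Suc s \<le> card {v. (v, a) \<in> E}"
  let ?B = "\<lambda>E. \<exists>h\<in>{1..n}. dense_rainbow k n m h (f * h) E"
  have "rbg_prob n m p (\<lambda>E. \<not> ?Q E) \<le> rbg_prob n m p (\<lambda>E. ?A E \<or> ?B E)"
  proof (rule rbg_prob_mono[OF p], rule ccontr)
    fix E assume E: "E \<subseteq> {0..<n} \<times> {0..<m}" "\<not> ?Q E" "\<not> (?A E \<or> ?B E)"
    have "?Q E" by (rule top_grad_le[OF n E(1)]) (use E(3) in \<open>auto simp: not_less_eq_eq\<close>)
    then show False using E(2) by simp
  qed
  also have "\<dots> \<le> rbg_prob n m p ?A + rbg_prob n m p ?B" by (rule rbg_prob_disj_le[OF p])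
  also have "\<dots> \<le> real m * (real n * p) ^ Suc s + 1 / real n"
    by (intro add_mono rbg_prob_large_attribute[OF p zero_less_Suc] rbg_prob_dense_rainbow_le[OF p n c f])
  finally show ?thesis by (simp add: rbg_prob_not)
qed

section \<open>Asymptotics for the given parameters\<close>

theorem mainTheorem6:
  fixes \<alpha> \<beta> \<gamma> :: real
  assumes "\<alpha> > 1" and "\<beta> > 0" and "\<gamma> > 0"
  shows "\<exists>f :: nat \<Rightarrow> real. \<forall>k :: nat.
           (\<lambda>n. rbg_prob n (nat \<lfloor>\<beta> * real n powr \<alpha>\<rfloor>) (\<gamma> * real n powr (-(1 + \<alpha>) / 2))
                  (\<lambda>E. top_grad k n E \<le> f k)) \<longlonglongrightarrow> 1"
proof -
  \<comment> \<open>The powers of \<open>n\<close> in \<open>m * n * p ^ 2\<close> cancel, leaving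
    the bound \<open>\<beta> * \<gamma> ^ 2\<close>.\<close>
  define c where "c = \<beta> * \<gamma>\<^sup>2"
  \<comment> \<open>Chosen so that \<open>Suc s\<close> exceeds
    \<open>2 * \<alpha> / (\<alpha> - 1)\<close>. This makes negative the exponent
    \<open>\<delta>\<close> of \<open>n\<close> in the bound for
    \<open>m * (n * p) ^ Suc s\<close>.\<close>
  define s where "s = nat \<lceil>2 * \<alpha> / (\<alpha> - 1)\<rceil>"
  define F where "F k = nat \<lceil>2 * exp 1 * exp 1 * (\<Sum>l\<le>k. c ^ (l + 1))\<rceil> + 2" for k
  define \<delta> where "\<delta> = \<alpha> + real (Suc s) * ((1 - \<alpha>) / 2)"
  define err where "err n = \<beta> * \<gamma> ^ Suc s * real n powr \<delta> + 1 / real n" for n :: nat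
  have F: "2 \<le> F k" "2 * exp 1 * exp 1 * (\<Sum>l\<le>k. c ^ (l + 1)) \<le> real (F k)" for k
  proof -
    show "2 \<le> F k" by (simp add: F_def)
    have "2 * exp 1 * exp 1 * (\<Sum>l\<le>k. c ^ (l + 1)) \<le>
        real (nat \<lceil>2 * exp 1 * exp 1 * (\<Sum>l\<le>k. c ^ (l + 1))\<rceil>)" by (rule real_nat_ceiling_ge)
    then show "2 * exp 1 * exp 1 * (\<Sum>l\<le>k. c ^ (l + 1)) \<le> real (F k)" by (simp add: F_def)
  qed
  have "2 * \<alpha> / (\<alpha> - 1) < real (Suc s)"
    using real_nat_ceiling_ge[of "2 * \<alpha> / (\<alpha> - 1)"] by (simp add: s_def)
  then have "\<delta> < 0" using assms(1) by (simp add: \<delta>_def field_simps)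
  have "(\<lambda>n. real n powr \<delta>) \<longlonglongrightarrow> 0"
    by (rule tendsto_neg_powr[OF \<open>\<delta> < 0\<close> filterlim_real_sequentially])
  then have "(\<lambda>n. 1 - err n) \<longlonglongrightarrow> 1 - (\<beta> * \<gamma> ^ Suc s * 0 + 0)"
    unfolding err_def by (intro tendsto_intros lim_1_over_n)
  then have err: "(\<lambda>n. 1 - err n) \<longlonglongrightarrow> 1" by simp
  have "(\<lambda>n. \<gamma> * real n powr (-(1 + \<alpha>) / 2)) \<longlonglongrightarrow> \<gamma> * 0"
    by (intro tendsto_mult tendsto_const tendsto_neg_powr filterlim_real_sequentially) (use assms in auto)
  \<comment> \<open>Only for large \<open>n\<close> is the edge parameter known to be at most 1, as
    the probability estimates require.\<close>
  then have small: "\<forall>\<^sub>F n in sequentially. \<gamma> * real n powr (-(1 + \<alpha>) / 2) < 1"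
    by (rule order_tendstoD) simp
  have "(\<lambda>n. rbg_prob n (nat \<lfloor>\<beta> * real n powr \<alpha>\<rfloor>) (\<gamma> * real n powr (-(1 + \<alpha>) / 2))
          (\<lambda>E. top_grad k n E \<le> real ((k + 1) * 2 ^ s * F k))) \<longlonglongrightarrow> 1" for k
  proof (rule tendsto_sandwich[OF _ _ err tendsto_const])
    show "\<forall>\<^sub>F n in sequentially. rbg_prob n (nat \<lfloor>\<beta> * real n powr \<alpha>\<rfloor>) (\<gamma> * real n powr (-(1 + \<alpha>) / 2))
          (\<lambda>E. top_grad k n E \<le> real ((k + 1) * 2 ^ s * F k)) \<le> 1"
      using small by eventually_elim (use assms in \<open>auto intro!: rbg_prob_le_1\<close>)
    show "\<forall>\<^sub>F n in sequentially. 1 - err n \<le>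
        rbg_prob n (nat \<lfloor>\<beta> * real n powr \<alpha>\<rfloor>) (\<gamma> * real n powr (-(1 + \<alpha>) / 2))
          (\<lambda>E. top_grad k n E \<le> real ((k + 1) * 2 ^ s * F k))"
      using small eventually_gt_at_top[of 0]
    proof eventually_elim
      case (elim n)
      let ?m = "nat \<lfloor>\<beta> * real n powr \<alpha>\<rfloor>" and ?p = "\<gamma> * real n powr (-(1 + \<alpha>) / 2)"
      have p: "0 \<le> ?p" "?p \<le> 1" using elim assms by auto
      have m: "real ?m \<le> \<beta> * real n powr \<alpha>" using assms by (intro of_nat_floor) auto
      have n: "real n = real n powr 1" using elim by simp
      have "real ?m * real n * ?p\<^sup>2 \<le> (\<beta> * real n powr \<alpha>) * real n * ?p\<^sup>2"
        using m by (intro mult_right_mono) auto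
      also have "\<dots> = c * (real n powr \<alpha> * real n powr 1 * (real n powr (-(1 + \<alpha>) / 2) * real n powr (-(1 + \<alpha>) / 2)))"
        using n by (simp add: c_def power2_eq_square mult_ac)
      also have "\<dots> = c * real n powr 0"
        unfolding powr_add[symmetric] by (simp add: field_simps)
      also have "\<dots> = c" using elim by simp
      finally have mnp: "real ?m * real n * ?p\<^sup>2 \<le> c" .
      have "real n * ?p = \<gamma> * (real n powr 1 * real n powr (-(1 + \<alpha>) / 2))" using n by simp
      also have "\<dots> = \<gamma> * real n powr ((1 - \<alpha>) / 2)"
        unfolding powr_add[symmetric] by (simp add: field_simps)
      finally have np: "real n * ?p = \<gamma> * real n powr ((1 - \<alpha>) / 2)" .
      have pw: "(real n powr ((1 - \<alpha>) / 2)) ^ Suc s = real n powr (real (Suc s) * ((1 - \<alpha>) / 2))"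
        using elim by (simp add: powr_power mult.commute del: power_Suc of_nat_Suc)
      have "real ?m * (real n * ?p) ^ Suc s \<le> (\<beta> * real n powr \<alpha>) * (real n * ?p) ^ Suc s"
        using m p by (intro mult_right_mono) auto
      also have "\<dots> = \<beta> * \<gamma> ^ Suc s * (real n powr \<alpha> * real n powr (real (Suc s) * ((1 - \<alpha>) / 2)))"
        unfolding np power_mult_distrib pw by (simp only: mult_ac)
      also have "\<dots> = \<beta> * \<gamma> ^ Suc s * real n powr \<delta>" by (simp only: powr_add[symmetric] \<delta>_def)
      finally show ?case
        using rbg_prob_top_grad_ge[OF p elim(2) mnp F, of s k] unfolding err_def by linarith
    qed
  qed
  then show ?thesis by (intro exI[of _ "\<lambda>k. real ((k + 1) * 2 ^ s * F k)"]) blast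
qed

end
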